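(* Let $\mathcal{P}$ be an instance of the discrete data-center optimization problem in which $m$ is a power of two with $m\ge 4$, and let $K=\log_2 m-2$. Consider the following procedure. In iteration $k=K$, compute a schedule $\hat X^K$ of minimum cost among all schedules with $x_t\in\{0,m/4,m/2,3m/4,m\}$ for all $t$. For $k=K,K-1,\dots,1$, given the schedule $\hat X^k=(\hat x^k_1,\dots,\hat x^k_T)$ from iteration $k$, iteration $k-1$ computes a schedule $\hat X^{k-1}$ of minimum cost among all schedules with $x_t\in V^{k-1}_t$ for all $t$, where $V^{k-1}_t=\{\hat x^k_t+\xi\cdot 2^{k-1}:\xi\in\{-2,-1,0,1,2\}\}\cap\{0,\dots,m\}$. The procedure outputs $\hat X^0$. Then $\hat X^0$ is an optimal schedule for $\mathcal{P}$.
   Context: Discrete data-center optimization problem: an instance $\mathcal{P}$ consists of $T\in\mathbb{N}$, $m\in\mathbb{N}$, $\beta>0$ and functions $f_1,\dots,f_T:\{0,\dots,m\}\to\mathbb{R}_{\ge0}$, each convex (i.e. $f_t(x+1)-f_t(x)$ is nondecreasing in $x$). A schedule is $X=(x_1,\dots,x_T)$ with $x_t\in\{0,\dots,m\}$; with $x_0=0$ its cost is $C(X)=\sum_{t=1}^T f_t(x_t)+\beta\sum_{t=1}^T(x_t-x_{t-1})^+$, where $(y)^+=\max(0,y)$. A schedule is optimal if it minimizes $C$ over $\{0,\dots,m\}^T$. *)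

theory Defs
  imports Complex_Main "HOL-Library.FuncSet"
begin

definition instance_dc :: "nat \<Rightarrow> nat \<Rightarrow> real \<Rightarrow> (nat \<Rightarrow> nat \<Rightarrow> real) \<Rightarrow> bool" where
  "instance_dc T m \<beta> f \<longleftrightarrow>
     \<beta> > 0 \<and>
     (\<forall>t\<in>{1..T}. (\<forall>x\<in>{0..m}. f t x \<ge> 0) \<and>
                 mono_on {0..<m} (\<lambda>x. f t (x + 1) - f t x))"

(* The tuple (x_1, ..., x_T) is a function on {1..T}, undefined elsewhere;
   V t is the set of states allowed at time t. *)
definition schedules :: "nat \<Rightarrow> (nat \<Rightarrow> nat set) \<Rightarrow> (nat \<Rightarrow> nat) set" where
  "schedules T V = (\<Pi>\<^sub>E t\<in>{1..T}. V t)"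

(* x_0 = 0 is not stored in the schedule itself. *)
definition state :: "(nat \<Rightarrow> nat) \<Rightarrow> nat \<Rightarrow> nat" where
  "state X t = (if t = 0 then 0 else X t)"

definition cost :: "nat \<Rightarrow> real \<Rightarrow> (nat \<Rightarrow> nat \<Rightarrow> real) \<Rightarrow> (nat \<Rightarrow> nat) \<Rightarrow> real" where
  "cost T \<beta> f X =
     (\<Sum>t=1..T. f t (X t)) +
     \<beta> * (\<Sum>t=1..T. max 0 (real (state X t) - real (state X (t - 1))))"

definition min_cost_schedule ::
  "nat \<Rightarrow> real \<Rightarrow> (nat \<Rightarrow> nat \<Rightarrow> real) \<Rightarrow> (nat \<Rightarrow> nat set) \<Rightarrow> (nat \<Rightarrow> nat) \<Rightarrow> bool" where
  "min_cost_schedule T \<beta> f V X \<longleftrightarrow> is_arg_min (cost T \<beta> f) (\<lambda>Y. Y \<in> schedules T V) X"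

definition optimal_schedule ::
  "nat \<Rightarrow> nat \<Rightarrow> real \<Rightarrow> (nat \<Rightarrow> nat \<Rightarrow> real) \<Rightarrow> (nat \<Rightarrow> nat) \<Rightarrow> bool" where
  "optimal_schedule T m \<beta> f X \<longleftrightarrow> min_cost_schedule T \<beta> f (\<lambda>t. {0..m}) X"

(* Both divisions are exact when 4 divides m. *)
definition initial_states :: "nat \<Rightarrow> nat set" where
  "initial_states m = {0, m div 4, m div 2, 3 * m div 4, m}"

(* refined_states m l X t is V^l_t built from the schedule X of iteration l + 1;
   the offsets are computed in the integers since they may be negative. *)
definition refined_states :: "nat \<Rightarrow> nat \<Rightarrow> (nat \<Rightarrow> nat) \<Rightarrow> nat \<Rightarrow> nat set" where
  "refined_states m l X t =
     {v \<in> {0..m}. \<exists>\<xi>\<in>{-2, -1, 0, 1, 2 :: int}. int v = int (X t) + \<xi> * 2 ^ l}"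

(* Xh k is the schedule of iteration k.  Minimisers need not be unique, so the procedure is a
   relation that admits every way of breaking ties. *)
definition procedure_run ::
  "nat \<Rightarrow> nat \<Rightarrow> real \<Rightarrow> (nat \<Rightarrow> nat \<Rightarrow> real) \<Rightarrow> nat \<Rightarrow> (nat \<Rightarrow> nat \<Rightarrow> nat) \<Rightarrow> bool" where
  "procedure_run T m \<beta> f K Xh \<longleftrightarrow>
     min_cost_schedule T \<beta> f (\<lambda>t. initial_states m) (Xh K) \<and>
     (\<forall>k\<in>{1..K}. min_cost_schedule T \<beta> f (refined_states m (k - 1) (Xh k)) (Xh (k - 1)))"

end

theory Submission
  imports Defs
begin

text \<open>
  In units of the finer grid, let P be an optimal schedule among those with even states and let A
  be any schedule. Replacing A by Y = max A (P - 2) does not increase the cost: with the two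
  even-valued schedules Z_i = min P (2 * ((A + i) div 2) + 2), i = 0, 1, one has pointwise, both for
  the convex operating costs and for the switching costs,
  2 * cost Y + cost Z_0 + cost Z_1 <= 2 * cost A + 2 * cost P,
  and cost P <= cost Z_i. The same holds for min A (P + 2) with Z_i = max P (2 * ((A + i) div 2) - 2).
  So some optimal schedule of the finer grid stays within distance 2 of P, i.e. inside the refined
  state sets, and each iteration is optimal on its grid.
\<close>

section \<open>Discrete convexity\<close>

text \<open>Each induction step adds the increment at \<open>a + k\<close> on the left and the one
  at \<open>b + k\<close> on the right, which is at least as large. The shifted point
  \<open>a + k\<close> may pass \<open>b\<close>; the shifts by 3 below rely on that.\<close>

lemma convex_exchange:
  fixes g :: "nat \<Rightarrow> real"
  assumes "mono_on {0..<n} (\<lambda>x. g (x + 1) - g x)" "a \<le> b" "b + k \<le> n"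
  shows "g (a + k) + g b \<le> g a + g (b + k)"
  using assms(3)
proof (induction k)
  case (Suc k)
  have "g (a + k + 1) - g (a + k) \<le> g (b + k + 1) - g (b + k)"
    using mono_onD[OF assms(1), of "a + k" "b + k"] assms(2) Suc.prems by simp
  with Suc show ?case by simp
qed simp

lemma convex_scale:
  fixes g :: "nat \<Rightarrow> real"
  assumes "mono_on {0..<d * n} (\<lambda>x. g (x + 1) - g x)"
  shows "mono_on {0..<n} (\<lambda>x. g (d * (x + 1)) - g (d * x))"
proof (rule mono_onI)
  fix x y assume "x \<in> {0..<n}" "y \<in> {0..<n}" and "x \<le> y"
  moreover from this have "d * y + d \<le> d * n"
    by (metis Suc_leI add.commute atLeastLessThan_iff mult_Suc_right mult_le_mono2)
  ultimately show "g (d * (x + 1)) - g (d * x) \<le> g (d * (y + 1)) - g (d * y)"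
    using convex_exchange[OF assms, of "d * x" "d * y" d] by (simp add: algebra_simps)
qed

section \<open>Exchange maps and their case analysis\<close>

definition raise :: "nat \<Rightarrow> nat \<Rightarrow> nat" where
  "raise p a = max a (p - 2)"

definition lower :: "nat \<Rightarrow> nat \<Rightarrow> nat" where
  "lower p a = min a (p + 2)"

text \<open>The natural partner of \<open>raise p a\<close> is \<open>min p (a + 2)\<close>, since
  the two sum to \<open>a + p\<close>; but it may be odd and then cannot be compared with an optimal
  even schedule. For even \<open>p\<close> it is the average of the two even values obtained with
  \<open>i = 0\<close> (rounding down) and \<open>i = 1\<close> (rounding up).\<close>

definition raise_even :: "nat \<Rightarrow> nat \<Rightarrow> nat \<Rightarrow> nat" where
  "raise_even i p a = min p (2 * ((a + i) div 2) + 2)"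

definition lower_even :: "nat \<Rightarrow> nat \<Rightarrow> nat \<Rightarrow> nat" where
  "lower_even i p a = max p (2 * ((a + i) div 2) - 2)"

text \<open>Parity keeps rounding and capping apart: an even \<open>p \<le> a + 2\<close> is not
  undercut by either rounding, and if \<open>a + 2 < p\<close> then even the value rounded up is at
  most \<open>p\<close>.\<close>

lemma raise_split:
  assumes "even p"
  obtains "p \<le> a + 2" "raise p a = a" "raise_even 0 p a = p" "raise_even 1 p a = p"
  | "a + 2 < p" "even a" "raise p a = p - 2" "raise_even 0 p a = a + 2" "raise_even 1 p a = a + 2"
  | "a + 2 < p" "odd a" "raise p a = p - 2" "raise_even 0 p a = a + 1" "raise_even 1 p a = a + 3"
proof (cases "p \<le> a + 2")
  case True
  then have "p \<le> 2 * (a div 2) + 2" "p \<le> 2 * ((a + 1) div 2) + 2"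
    using assms by presburger+
  with True that(1) show thesis by (simp add: raise_def raise_even_def min_absorb1)
next
  case False
  with that(2,3) assms show thesis
    by (cases "even a") (auto simp: raise_def raise_even_def elim!: evenE oddE)
qed

lemma lower_split:
  assumes "even p"
  obtains "a \<le> p + 2" "lower p a = a" "lower_even 0 p a = p" "lower_even 1 p a = p"
  | "p + 2 < a" "even a" "lower p a = p + 2" "lower_even 0 p a = a - 2" "lower_even 1 p a = a - 2"
  | "p + 2 < a" "odd a" "lower p a = p + 2" "lower_even 0 p a = a - 3" "lower_even 1 p a = a - 1"
proof (cases "a \<le> p + 2")
  case True
  then have "2 * (a div 2) - 2 \<le> p" "2 * ((a + 1) div 2) - 2 \<le> p"
    using assms by presburger+
  with True that(1) show thesis by (simp add: lower_def lower_even_def max_absorb1)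
next
  case False
  with that(2,3) assms show thesis
    by (cases "even a") (auto simp: lower_def lower_even_def elim!: evenE oddE)
qed

section \<open>Operating costs under the exchange\<close>

text \<open>The four arguments on the left have the same sum as those on the right and lie between
  \<open>a\<close> and \<open>p\<close>, so convexity favours them.\<close>

lemma node_raise:
  fixes g :: "nat \<Rightarrow> real"
  assumes g: "mono_on {0..<n} (\<lambda>x. g (x + 1) - g x)" and "even p" "p \<le> n"
  shows "2 * g (raise p a) + g (raise_even 0 p a) + g (raise_even 1 p a) \<le> 2 * g a + 2 * g p"
proof (cases rule: raise_split[OF \<open>even p\<close>, of a])
  case 1
  then show ?thesis by simp
next
  case 2
  then have "a \<le> p - 2" "p - 2 + 2 = p" by auto
  with convex_exchange[OF g, of a "p - 2" 2] 2 \<open>p \<le> n\<close> show ?thesis by simp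
next
  case 3
  then have "p = p - 3 + 3" "a \<le> p - 3" by auto
  then obtain c where c: "p = c + 3" "a \<le> c" by (rule that)
  \<comment> \<open>The target is \<open>2 * g (c + 1)\<close>, but the moves by 1 and 3 leave
    \<open>g (c + 2)\<close> and \<open>g c\<close>. Midpoint convexity at \<open>c + 1\<close>
    joins these, and they cancel when the three inequalities are added.\<close>
  have "g (a + 1) + g (c + 2) \<le> g a + g (c + 3)"
    using convex_exchange[OF g, of a "c + 2" 1] c \<open>p \<le> n\<close> by (simp add: numeral_eq_Suc)
  moreover have "g (a + 3) + g c \<le> g a + g (c + 3)"
    using convex_exchange[OF g, of a c 3] c \<open>p \<le> n\<close> by simp
  moreover have "2 * g (c + 1) \<le> g c + g (c + 2)"
    using convex_exchange[OF g, of c "c + 1" 1] c \<open>p \<le> n\<close> by simp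
  ultimately show ?thesis using 3 c by simp
qed

lemma node_lower:
  fixes g :: "nat \<Rightarrow> real"
  assumes g: "mono_on {0..<n} (\<lambda>x. g (x + 1) - g x)" and "even p" "a \<le> n"
  shows "2 * g (lower p a) + g (lower_even 0 p a) + g (lower_even 1 p a) \<le> 2 * g a + 2 * g p"
proof (cases rule: lower_split[OF \<open>even p\<close>, of a])
  case 1
  then show ?thesis by simp
next
  case 2
  then have "p \<le> a - 2" "a - 2 + 2 = a" by auto
  with convex_exchange[OF g, of p "a - 2" 2] 2 \<open>a \<le> n\<close> show ?thesis by simp
next
  case 3
  then have "a = a - 3 + 3" "p \<le> a - 3" by auto
  then obtain c where c: "a = c + 3" "p \<le> c" by (rule that)
  \<comment> \<open>Mirror image: the auxiliary values are now \<open>g (p + 1)\<close> and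
    \<open>g (p + 3)\<close>, on either side of \<open>p + 2\<close>.\<close>
  have "g (p + 1) + g (c + 2) \<le> g p + g (c + 3)"
    using convex_exchange[OF g, of p "c + 2" 1] c \<open>a \<le> n\<close> by (simp add: numeral_eq_Suc)
  moreover have "g (p + 3) + g c \<le> g p + g (c + 3)"
    using convex_exchange[OF g, of p c 3] c \<open>a \<le> n\<close> by simp
  moreover have "2 * g (p + 2) \<le> g (p + 1) + g (p + 3)"
    using convex_exchange[OF g, of "p + 1" "p + 2" 1] c \<open>a \<le> n\<close> by (simp add: numeral_eq_Suc)
  ultimately show ?thesis using 3 c by simp
qed

section \<open>Switching costs under the exchange\<close>

text \<open>Truncated subtraction is piecewise linear with its kink at \<open>x = y\<close>. Odd
  parity excludes that point, so both neighbours of \<open>x\<close> lie on the same linear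
  piece.\<close>

lemma diff_midpoint_left:
  fixes x y :: nat
  assumes "odd (x + y)"
  shows "(x - 1 - y) + (x + 1 - y) = 2 * (x - y)"
proof -
  have "x < y \<or> y < x"
    using assms by presburger
  then show ?thesis by auto
qed

lemma diff_midpoint_right:
  fixes x y :: nat
  assumes "odd (x + y)" "1 \<le> y"
  shows "(x - (y - 1)) + (x - (y + 1)) = 2 * (x - y)"
proof -
  have "x < y \<or> y < x"
    using assms by presburger
  with assms(2) show ?thesis by auto
qed

text \<open>Averaging over the two roundings loses nothing. If both ends are odd and rounded, they
  shift together; if only one is, the other end is even and the midpoint identity applies. The four
  explicit cases are those with exactly one rounded end.\<close>

lemma raise_even_diff:
  assumes "even p" "even q"
  shows "(raise_even 0 p a - raise_even 0 q b) + (raise_even 1 p a - raise_even 1 q b)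
    = 2 * (min p (a + 2) - min q (b + 2))"
proof (cases rule: raise_split[OF assms(1), of a]; cases rule: raise_split[OF assms(2), of b])
  assume "p \<le> a + 2" "raise_even 0 p a = p" "raise_even 1 p a = p"
    and "b + 2 < q" "odd b" "raise_even 0 q b = b + 1" "raise_even 1 q b = b + 3"
  then show ?thesis using diff_midpoint_right[of p "b + 2"] assms by simp
next
  assume "a + 2 < p" "even a" "raise_even 0 p a = a + 2" "raise_even 1 p a = a + 2"
    and "b + 2 < q" "odd b" "raise_even 0 q b = b + 1" "raise_even 1 q b = b + 3"
  then show ?thesis using diff_midpoint_right[of "a + 2" "b + 2"] assms by simp
next
  assume "a + 2 < p" "odd a" "raise_even 0 p a = a + 1" "raise_even 1 p a = a + 3"
    and "q \<le> b + 2" "raise_even 0 q b = q" "raise_even 1 q b = q"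
  then show ?thesis using diff_midpoint_left[of "a + 2" q] assms by simp
next
  assume "a + 2 < p" "odd a" "raise_even 0 p a = a + 1" "raise_even 1 p a = a + 3"
    and "b + 2 < q" "even b" "raise_even 0 q b = b + 2" "raise_even 1 q b = b + 2"
  then show ?thesis using diff_midpoint_left[of "a + 2" "b + 2"] assms by simp
qed simp_all

lemma lower_even_diff:
  assumes "even p" "even q"
  shows "(lower_even 0 p a - lower_even 0 q b) + (lower_even 1 p a - lower_even 1 q b)
    = 2 * (max p (a - 2) - max q (b - 2))"
proof (cases rule: lower_split[OF assms(1), of a]; cases rule: lower_split[OF assms(2), of b])
  assume *: "a \<le> p + 2" "lower_even 0 p a = p" "lower_even 1 p a = p"
    and b: "q + 2 < b" "odd b" "lower_even 0 q b = b - 3" "lower_even 1 q b = b - 1"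
  have "b - 2 - 1 = b - 3" "b - 2 + 1 = b - 1" using b by auto
  then show ?thesis using diff_midpoint_right[of p "b - 2"] assms * b
    by (simp add: max_absorb1 max_absorb2)
next
  assume a: "p + 2 < a" "even a" "lower_even 0 p a = a - 2" "lower_even 1 p a = a - 2"
    and b: "q + 2 < b" "odd b" "lower_even 0 q b = b - 3" "lower_even 1 q b = b - 1"
  have "b - 2 - 1 = b - 3" "b - 2 + 1 = b - 1" using b by auto
  then show ?thesis using diff_midpoint_right[of "a - 2" "b - 2"] assms a b
    by (simp add: max_absorb1 max_absorb2)
next
  assume a: "p + 2 < a" "odd a" "lower_even 0 p a = a - 3" "lower_even 1 p a = a - 1"
    and *: "b \<le> q + 2" "lower_even 0 q b = q" "lower_even 1 q b = q"
  have "a - 2 - 1 = a - 3" "a - 2 + 1 = a - 1" using a by auto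
  then show ?thesis using diff_midpoint_left[of "a - 2" q] assms a *
    by (simp add: max_absorb1 max_absorb2)
next
  assume a: "p + 2 < a" "odd a" "lower_even 0 p a = a - 3" "lower_even 1 p a = a - 1"
    and b: "q + 2 < b" "even b" "lower_even 0 q b = b - 2" "lower_even 1 q b = b - 2"
  have "a - 2 - 1 = a - 3" "a - 2 + 1 = a - 1" using a by auto
  moreover have "max p (a - 2) = a - 2" "max q (b - 2) = b - 2" using a b by auto
  ultimately show ?thesis using diff_midpoint_left[of "a - 2" "b - 2"] assms a b
    by simp
qed (simp_all add: max_absorb1 max_absorb2)

text \<open>Without rounding this is submodularity of the positive part of a difference, for the max
  and min of \<open>a\<close> and \<open>p - 2\<close>; adding 2 to both ends of the min does not
  alter their difference. The rounded pair then replaces the min exactly.\<close>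

lemma edge_raise:
  assumes "even p" "even q"
  shows "2 * (raise p a - raise q b) + (raise_even 0 p a - raise_even 0 q b)
      + (raise_even 1 p a - raise_even 1 q b) \<le> 2 * (a - b) + 2 * (p - q)"
proof -
  have "(raise p a - raise q b) + (min p (a + 2) - min q (b + 2)) \<le> (a - b) + (p - q)"
    unfolding raise_def by (cases "p \<le> a + 2"; cases "q \<le> b + 2") auto
  with raise_even_diff[OF assms, of a b] show ?thesis by linarith
qed

lemma edge_lower:
  assumes "even p" "even q"
  shows "2 * (lower p a - lower q b) + (lower_even 0 p a - lower_even 0 q b)
      + (lower_even 1 p a - lower_even 1 q b) \<le> 2 * (a - b) + 2 * (p - q)"
proof -
  have "(lower p a - lower q b) + (max p (a - 2) - max q (b - 2)) \<le> (a - b) + (p - q)"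
    unfolding lower_def by (cases "a \<le> p + 2"; cases "b \<le> q + 2") auto
  with lower_even_diff[OF assms, of a b] show ?thesis by linarith
qed

section \<open>Costs of whole schedules\<close>

lemma state_map2:
  assumes "h 0 0 = 0"
  shows "state (\<lambda>t. h (P t) (A t)) s = h (state P s) (state A s)"
  using assms by (simp add: state_def)

lemma cost_cong:
  assumes "\<And>t. t \<in> {1..T} \<Longrightarrow> X t = Y t"
  shows "cost T \<beta> f X = cost T \<beta> f Y"
proof -
  have "state X s = state Y s" if "s \<le> T" for s
    using assms[of s] that by (auto simp: state_def)
  then show ?thesis
    unfolding cost_def by (auto intro!: arg_cong2[where f = "(+)"] sum.cong simp: assms)
qed

text \<open>Switching cost is homogeneous in the states, so a change of unit is absorbed into
  \<open>\<beta>\<close> and every grid can be treated as one of spacing 1.\<close>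

lemma cost_scale:
  "cost T \<beta> f (\<lambda>t. d * a t) = cost T (real d * \<beta>) (\<lambda>t j. f t (d * j)) a"
proof -
  have max: "max 0 (real (d * u) - real (d * v)) = real d * max 0 (real u - real v)" for u v
    using max_mult_distrib_left[of "real d" 0 "real u - real v"] by (simp add: right_diff_distrib)
  have state: "state (\<lambda>t. d * a t) s = d * state a s" for s
    by (simp add: state_def)
  have "(\<Sum>t=1..T. max 0 (real (state (\<lambda>t. d * a t) t) - real (state (\<lambda>t. d * a t) (t - 1))))
    = real d * (\<Sum>t=1..T. max 0 (real (state a t) - real (state a (t - 1))))"
    unfolding state max sum_distrib_left ..
  then show ?thesis
    by (simp add: cost_def)
qed

lemma cost_exchange:
  assumes "\<beta> \<ge> 0"
    and node: "\<And>t. t \<in> {1..T} \<Longrightarrow>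
      2 * f t (Y t) + f t (Z0 t) + f t (Z1 t) \<le> 2 * f t (A t) + 2 * f t (P t)"
    and edge: "\<And>t. t \<in> {1..T} \<Longrightarrow>
      2 * (state Y t - state Y (t - 1)) + (state Z0 t - state Z0 (t - 1))
        + (state Z1 t - state Z1 (t - 1))
      \<le> 2 * (state A t - state A (t - 1)) + 2 * (state P t - state P (t - 1))"
  shows "2 * cost T \<beta> f Y + cost T \<beta> f Z0 + cost T \<beta> f Z1 \<le> 2 * cost T \<beta> f A + 2 * cost T \<beta> f P"
proof -
  define N where "N X = (\<Sum>t=1..T. f t (X t))" for X
  define E where "E X = (\<Sum>t=1..T. state X t - state X (t - 1))" for X
  \<comment> \<open>Truncated subtraction of naturals is the positive part, so switching costs can
    be summed in \<open>nat\<close>.\<close>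
  have "max 0 (real a - real b) = real (a - b)" for a b
    by (simp add: max_def of_nat_diff)
  then have cost: "cost T \<beta> f X = N X + \<beta> * real (E X)" for X
    by (simp add: cost_def N_def E_def)
  have "2 * N Y + N Z0 + N Z1 \<le> 2 * N A + 2 * N P"
    using sum_mono[of "{1..T}", OF node] unfolding N_def by (simp add: sum.distrib sum_distrib_left)
  moreover have "2 * E Y + E Z0 + E Z1 \<le> 2 * E A + 2 * E P"
    using sum_mono[of "{1..T}", OF edge] unfolding E_def by (simp add: sum.distrib sum_distrib_left)
  then have "\<beta> * real (2 * E Y + E Z0 + E Z1) \<le> \<beta> * real (2 * E A + 2 * E P)"
    using \<open>\<beta> \<ge> 0\<close> by (intro mult_left_mono) (simp_all only: of_nat_le_iff)
  ultimately show ?thesis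
    unfolding cost by (simp add: algebra_simps)
qed

section \<open>Proximity of optimal schedules on successive grids\<close>

lemma proximity:
  assumes convex: "\<And>t. t \<in> {1..T} \<Longrightarrow> mono_on {0..<n} (\<lambda>x. f t (x + 1) - f t x)"
    and "\<beta> \<ge> 0" "even n"
    and P: "\<And>t. t \<in> {1..T} \<Longrightarrow> even (P t) \<and> P t \<le> n"
    and opt: "\<And>Z. (\<And>t. t \<in> {1..T} \<Longrightarrow> even (Z t) \<and> Z t \<le> n) \<Longrightarrow> cost T \<beta> f P \<le> cost T \<beta> f Z"
    and A: "\<And>t. t \<in> {1..T} \<Longrightarrow> A t \<le> n"
  obtains Y where "\<And>t. t \<in> {1..T} \<Longrightarrow> Y t \<le> n \<and> P t \<le> Y t + 2 \<and> Y t \<le> P t + 2"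
    and "cost T \<beta> f Y \<le> cost T \<beta> f A"
proof
  \<comment> \<open>The fixed state 0 at time 0 is even as well, so the edge inequalities also cover
    the first switch.\<close>
  have even_state: "even (state P s)" if "s \<le> T" for s
    using P[of s] that by (auto simp: state_def)
  define B where "B t = raise (P t) (A t)" for t
  \<comment> \<open>Capping at \<open>P t + 2\<close> cannot destroy the lower bound
    \<open>P t - 2\<close> already secured by \<open>B\<close>.\<close>
  define Y where "Y t = lower (P t) (B t)" for t
  have B: "B t \<le> n" if "t \<in> {1..T}" for t
    using P[OF that] A[OF that] by (auto simp: B_def raise_def)
  show "Y t \<le> n \<and> P t \<le> Y t + 2 \<and> Y t \<le> P t + 2" if "t \<in> {1..T}" for t
    using P[OF that] B[OF that] by (auto simp: Y_def B_def lower_def raise_def)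
  have "2 * cost T \<beta> f B + cost T \<beta> f (\<lambda>t. raise_even 0 (P t) (A t))
      + cost T \<beta> f (\<lambda>t. raise_even 1 (P t) (A t)) \<le> 2 * cost T \<beta> f A + 2 * cost T \<beta> f P"
  proof (rule cost_exchange[OF \<open>\<beta> \<ge> 0\<close>])
    fix t assume t: "t \<in> {1..T}"
    then have "t \<le> T" "t - 1 \<le> T" by auto
    from t show "2 * f t (B t) + f t (raise_even 0 (P t) (A t)) + f t (raise_even 1 (P t) (A t))
        \<le> 2 * f t (A t) + 2 * f t (P t)"
      using node_raise[OF convex] P by (simp add: B_def)
    show "2 * (state B t - state B (t - 1))
        + (state (\<lambda>t. raise_even 0 (P t) (A t)) t - state (\<lambda>t. raise_even 0 (P t) (A t)) (t - 1))
        + (state (\<lambda>t. raise_even 1 (P t) (A t)) t - state (\<lambda>t. raise_even 1 (P t) (A t)) (t - 1))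
      \<le> 2 * (state A t - state A (t - 1)) + 2 * (state P t - state P (t - 1))"
      unfolding B_def using
        edge_raise[OF even_state even_state, OF \<open>t \<le> T\<close> \<open>t - 1 \<le> T\<close>, of "state A t" "state A (t - 1)"]
      by (simp add: state_map2[where h = raise] state_map2[where h = "raise_even _"]
          raise_def[of 0 0] raise_even_def[of _ 0 0])
  qed
  moreover have P_le: "cost T \<beta> f P \<le> cost T \<beta> f (\<lambda>t. raise_even i (P t) (A t))" for i
  proof (rule opt)
    fix t assume "t \<in> {1..T}"
    with P show "even (raise_even i (P t) (A t)) \<and> raise_even i (P t) (A t) \<le> n"
      by (simp add: raise_even_def min.coboundedI1) (simp add: min_def)
  qed
  ultimately have "cost T \<beta> f B \<le> cost T \<beta> f A"
    using P_le[of 0] P_le[of 1] by linarith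
  have "2 * cost T \<beta> f Y + cost T \<beta> f (\<lambda>t. lower_even 0 (P t) (B t))
      + cost T \<beta> f (\<lambda>t. lower_even 1 (P t) (B t)) \<le> 2 * cost T \<beta> f B + 2 * cost T \<beta> f P"
  proof (rule cost_exchange[OF \<open>\<beta> \<ge> 0\<close>])
    fix t assume t: "t \<in> {1..T}"
    then have "t \<le> T" "t - 1 \<le> T" by auto
    from t show "2 * f t (Y t) + f t (lower_even 0 (P t) (B t)) + f t (lower_even 1 (P t) (B t))
        \<le> 2 * f t (B t) + 2 * f t (P t)"
      using node_lower[OF convex] P B by (simp add: Y_def)
    show "2 * (state Y t - state Y (t - 1))
        + (state (\<lambda>t. lower_even 0 (P t) (B t)) t - state (\<lambda>t. lower_even 0 (P t) (B t)) (t - 1))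
        + (state (\<lambda>t. lower_even 1 (P t) (B t)) t - state (\<lambda>t. lower_even 1 (P t) (B t)) (t - 1))
      \<le> 2 * (state B t - state B (t - 1)) + 2 * (state P t - state P (t - 1))"
      unfolding Y_def using
        edge_lower[OF even_state even_state, OF \<open>t \<le> T\<close> \<open>t - 1 \<le> T\<close>, of "state B t" "state B (t - 1)"]
      by (simp add: state_map2[where h = lower] state_map2[where h = "lower_even _"]
          lower_def[of 0 0] lower_even_def[of _ 0 0])
  qed
  \<comment> \<open>Here no cap by \<open>P t\<close> bounds the value from above; a larger
    \<open>i\<close> could push it beyond \<open>n\<close>.\<close>
  moreover have P_le': "cost T \<beta> f P \<le> cost T \<beta> f (\<lambda>t. lower_even i (P t) (B t))" if "i \<le> 1" for i
  proof (rule opt)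
    fix t assume "t \<in> {1..T}"
    with P B that \<open>even n\<close> show "even (lower_even i (P t) (B t)) \<and> lower_even i (P t) (B t) \<le> n"
      by (fastforce simp: lower_even_def max_def)
  qed
  ultimately have "cost T \<beta> f Y \<le> cost T \<beta> f B"
    using P_le'[of 0] P_le'[of 1] by linarith
  with \<open>cost T \<beta> f B \<le> cost T \<beta> f A\<close> show "cost T \<beta> f Y \<le> cost T \<beta> f A" by simp
qed

section \<open>One refinement step\<close>

text \<open>Cost depends only on times 1 to \<open>T\<close>, so competitors need not be
  extensional; this admits schedules given by plain lambda terms.\<close>

lemma min_cost_schedule_iff:
  "min_cost_schedule T \<beta> f V X \<longleftrightarrow>
    X \<in> schedules T V \<and>
    (\<forall>Y. (\<forall>t\<in>{1..T}. Y t \<in> V t) \<longrightarrow> cost T \<beta> f X \<le> cost T \<beta> f Y)"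
proof -
  have "cost T \<beta> f X \<le> cost T \<beta> f Y"
    if "\<And>Z. Z \<in> schedules T V \<Longrightarrow> cost T \<beta> f X \<le> cost T \<beta> f Z" "\<forall>t\<in>{1..T}. Y t \<in> V t" for Y
  proof -
    have "cost T \<beta> f X \<le> cost T \<beta> f (restrict Y {1..T})"
      using that by (intro that(1)) (auto simp: schedules_def)
    also have "\<dots> = cost T \<beta> f Y"
      by (rule cost_cong) simp
    finally show ?thesis .
  qed
  then show ?thesis
    by (auto simp: min_cost_schedule_def is_arg_min_def not_less schedules_def PiE_mem)
qed

definition grid :: "nat \<Rightarrow> nat \<Rightarrow> nat set" where
  "grid m d = {x \<in> {0..m}. d dvd x}"

text \<open>Measured in units of \<open>2 ^ l\<close>, \<open>X\<close> is an optimal even schedule.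
  By proximity, every schedule on the finer grid is matched or beaten by one inside the refined
  state sets, where \<open>X'\<close> is minimal.\<close>

lemma refinement_step:
  assumes inst: "instance_dc T m \<beta> f"
    and dvd: "2 ^ Suc l dvd m"
    and X: "min_cost_schedule T \<beta> f (\<lambda>t. grid m (2 ^ Suc l)) X"
    and X': "min_cost_schedule T \<beta> f (refined_states m l X) X'"
  shows "min_cost_schedule T \<beta> f (\<lambda>t. grid m (2 ^ l)) X'"
proof -
  define d :: nat where "d = 2 ^ l"
  have "d > 0" by (simp add: d_def)
  from dvd obtain n where m: "m = d * n" and "even n"
    by (auto simp: d_def elim!: dvdE)
  define F where "F = (\<lambda>t j. f t (d * j))"
  define P where "P t = X t div d" for t
  have X_grid: "X t \<le> m \<and> 2 * d dvd X t" if "t \<in> {1..T}" for t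
    using X that by (auto simp: min_cost_schedule_iff schedules_def grid_def d_def)
  then have X_eq: "X t = d * P t" if "t \<in> {1..T}" for t
    using that by (simp add: P_def) (metis dvd_mult_div_cancel dvd_mult_right)
  have P: "even (P t) \<and> P t \<le> n" if "t \<in> {1..T}" for t
    using X_grid[OF that] X_eq[OF that] \<open>d > 0\<close> by (simp add: m mult.commute)
  have opt: "cost T (real d * \<beta>) F P \<le> cost T (real d * \<beta>) F Z"
    if "\<And>t. t \<in> {1..T} \<Longrightarrow> even (Z t) \<and> Z t \<le> n" for Z
  proof -
    have "cost T \<beta> f X \<le> cost T \<beta> f (\<lambda>t. d * Z t)"
      using X that by (auto simp: min_cost_schedule_iff grid_def m d_def mult.commute)
    then show ?thesis
      using cost_cong[of T X "\<lambda>t. d * P t"] X_eq by (simp add: cost_scale F_def)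
  qed
  have "cost T \<beta> f X' \<le> cost T \<beta> f B" if B: "\<forall>t\<in>{1..T}. B t \<in> grid m d" for B
  proof -
    define A where "A t = B t div d" for t
    have B_eq: "B t = d * A t" if "t \<in> {1..T}" for t
      using B that by (simp add: A_def grid_def)
    obtain Y where Y: "\<And>t. t \<in> {1..T} \<Longrightarrow> Y t \<le> n \<and> P t \<le> Y t + 2 \<and> Y t \<le> P t + 2"
      and le: "cost T (real d * \<beta>) F Y \<le> cost T (real d * \<beta>) F A"
    proof (rule proximity[of T n F "real d * \<beta>" P A])
      show "mono_on {0..<n} (\<lambda>x. F t (x + 1) - F t x)" if "t \<in> {1..T}" for t
        using inst that convex_scale[of d n "f t"] by (simp add: instance_dc_def F_def m)
      show "real d * \<beta> \<ge> 0"
        using inst by (simp add: instance_dc_def)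
      show "A t \<le> n" if "t \<in> {1..T}" for t
      proof -
        have "d * A t \<le> d * n"
          using B that B_eq[OF that] by (fastforce simp: grid_def m)
        then show ?thesis using \<open>d > 0\<close> by simp
      qed
    qed (use P opt \<open>even n\<close> in blast)+
    \<comment> \<open>Distance at most 2 in units of \<open>d\<close> is exactly the range of the
      offsets \<xi>.\<close>
    have "d * Y t \<in> refined_states m l X t" if t: "t \<in> {1..T}" for t
    proof -
      have "d * Y t \<le> m"
        using Y[OF t] by (simp add: m)
      have "int (d * Y t) = int (X t) + (int (Y t) - int (P t)) * 2 ^ l"
        by (simp add: X_eq[OF t] d_def algebra_simps)
      moreover have "int (Y t) - int (P t) \<in> {-2, -1, 0, 1, 2}"
        using Y[OF t] by auto
      ultimately show ?thesis
        using \<open>d * Y t \<le> m\<close> unfolding refined_states_def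
        by (simp only: mem_Collect_eq atLeastAtMost_iff) blast
    qed
    with X' have "cost T \<beta> f X' \<le> cost T \<beta> f (\<lambda>t. d * Y t)"
      by (simp add: min_cost_schedule_iff)
    also have "\<dots> \<le> cost T \<beta> f (\<lambda>t. d * A t)"
      using le by (simp add: cost_scale F_def)
    also have "\<dots> = cost T \<beta> f B"
      by (rule cost_cong) (simp add: B_eq)
    finally show ?thesis .
  qed
  moreover have "X' t \<in> grid m d" if t: "t \<in> {1..T}" for t
  proof -
    have "X' t \<in> refined_states m l X t"
      using X' t by (auto simp: min_cost_schedule_iff schedules_def)
    then obtain \<xi> where "X' t \<le> m" "int (X' t) = int (X t) + \<xi> * 2 ^ l"
      unfolding refined_states_def by (simp only: mem_Collect_eq atLeastAtMost_iff) blast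
    then have "int (X' t) = int d * int (P t) + \<xi> * int d"
      by (simp add: X_eq[OF t] d_def)
    then have "int (X' t) = int d * (int (P t) + \<xi>)"
      by (simp add: algebra_simps)
    then have "int d dvd int (X' t)" by simp
    with \<open>X' t \<le> m\<close> show ?thesis
      by (simp add: grid_def)
  qed
  ultimately show ?thesis
    using X' unfolding min_cost_schedule_iff d_def by (auto simp: schedules_def PiE_iff)
qed

section \<open>From the coarsest grid to all states\<close>

lemma initial_states_grid:
  assumes "m = 4 * d" "d > 0"
  shows "initial_states m = grid m d"
proof -
  have "grid m d = (\<lambda>j. d * j) ` {0..4}"
    using assms by (auto simp: grid_def elim!: dvdE)
  also have "{0..4::nat} = {0, 1, 2, 3, 4}" by auto
  finally show ?thesis
    using assms by (auto simp: initial_states_def)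
qed

theorem theorem2p6:
  fixes T m K :: nat
    and \<beta> :: real
    and f :: "nat \<Rightarrow> nat \<Rightarrow> real"
    and Xh :: "nat \<Rightarrow> nat \<Rightarrow> nat"
  assumes "instance_dc T m \<beta> f"
    and "\<exists>j::nat. m = 2 ^ j"
    and "m \<ge> 4"
    and "real K = log 2 (real m) - 2"
    and "procedure_run T m \<beta> f K Xh"
  shows "optimal_schedule T m \<beta> f (Xh 0)"
proof -
  obtain j where j: "m = 2 ^ j" using assms(2) by blast
  with assms(4) have "j = K + 2" by (simp add: log_nat_power)
  with j have m: "m = 4 * 2 ^ K" by simp
  \<comment> \<open>Invariant, by induction downwards from \<open>K\<close>: iteration
    \<open>k\<close> is optimal on the whole grid of spacing \<open>2 ^ k\<close>, not just on the
    states it searched. At \<open>k = 0\<close> this grid is \<open>{0..m}\<close>.\<close>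
  have "min_cost_schedule T \<beta> f (\<lambda>t. grid m (2 ^ k)) (Xh k)" if "k \<le> K" for k
    using that
  proof (induction rule: inc_induct)
    case base
    then show ?case
      using assms(5) initial_states_grid[OF m] by (simp add: procedure_run_def)
  next
    case (step k)
    have "(2::nat) ^ Suc k dvd 2 ^ K" using step.hyps by (intro le_imp_power_dvd) simp
    then have "2 ^ Suc k dvd m" by (simp add: m)
    moreover have "min_cost_schedule T \<beta> f (refined_states m k (Xh (Suc k))) (Xh k)"
      using assms(5) step.hyps unfolding procedure_run_def
      by (metis Suc_leI atLeastAtMost_iff diff_Suc_1 le_add1 plus_1_eq_Suc)
    ultimately show ?case using refinement_step[OF assms(1)] step.IH by blast
  qed
  from this[of 0] show ?thesis
    by (simp add: optimal_schedule_def grid_def atLeast0AtMost atMost_def)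
qed

end
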